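(* Let $(G,\omega,\mu)$ be an infinite weighted graph. Let $h:[0,+\infty)\to[0,+\infty)$ be a locally integrable function, and let $q>1$. Let $u_0:G\to\mathbb R$ be any nonnegative and bounded function. Then, provided that $T>0$ is sufficiently small, there exists a (nonnegative, mild) solution $u\in L^\infty((0,T);\ell^\infty(G))$ to the problem $$u_t=\Delta u+h(t)u^q \ \text{ in } G\times(0,T),\qquad u=u_0 \ \text{ in } G\times\{0\}.$$
   Context: Weighted infinite graph: $G$ is a countable infinite set, $\mu:G\to(0,+\infty)$ is a (node) measure, and $\omega:G\times G\to[0,+\infty)$ is an edge weight with $\omega(x,y)=\omega(y,x)$, $\omega(x,x)=0$ and $\sum_{y\in G}\omega(x,y)<\infty$ for all $x,y\in G$. Write $x\sim y$ if $\omega(x,y)>0$. The graph is always assumed locally finite (each $x$ has finitely many $y\sim x$), connected (any two distinct vertices are joined by a path $x_0\sim x_1\sim\dots\sim x_n$) and undirected. Laplacian: $\Delta f(x)=\frac1{\mu(x)}\sum_{y\in G}[f(y)-f(x)]\omega(x,y)$. $\ell^\infty(G)$ is the space of bounded functions $G\to\mathbb R$ with the sup norm. $p:G\times G\times(0,+\infty)\to(0,+\infty)$ is the (minimal) heat kernel of $(G,\omega,\mu)$, i.e. the kernel, with respect to $\mu$, of the heat semigroup $e^{t\Delta}$: $(e^{t\Delta}u_0)(x)=\sum_{y\in G}p(x,y,t)u_0(y)\mu(y)$ for $u_0\in\ell^\infty(G)$ (the smallest positive fundamental solution of $\partial_t p=\Delta p$ with $p(x,y,0^+)=\mathbf 1_{x=y}/\mu(x)$).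 Mild solution: solutions are understood in the mild sense, i.e. a nonnegative $u:G\times(0,\tau)\to\mathbb R$, $u\in L^\infty((0,\tau),\ell^\infty(G))$, is a mild solution in $G\times(0,\tau)$ if for every $x\in G$, $t\in(0,\tau)$, $$u(x,t)=\sum_{y\in G}p(x,y,t)u_0(y)\mu(y)+\int_0^t\sum_{y\in G}p(x,y,t-s)h(s)u(y,s)^q\mu(y)\,ds .$$ *)

theory Defs
  imports "HOL-Analysis.Analysis"
begin

text \<open>The vertex set is the whole type \<open>'a\<close>.\<close>

locale infinite_weighted_graph =
  fixes \<omega> :: "'a \<Rightarrow> 'a \<Rightarrow> real" and \<mu> :: "'a \<Rightarrow> real"
  assumes countable_vertices: "countable (UNIV :: 'a set)"
    and infinite_vertices: "infinite (UNIV :: 'a set)"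
    and measure_pos: "0 < \<mu> x"
    and weight_nonneg: "0 \<le> \<omega> x y"
    and weight_sym: "\<omega> x y = \<omega> y x"
    and weight_irrefl: "\<omega> x x = 0"
    and weight_summable: "\<omega> x summable_on UNIV"
    and locally_finite: "finite {y. 0 < \<omega> x y}"
    and connected: "x \<noteq> y \<Longrightarrow> (\<lambda>v w. 0 < \<omega> v w)\<^sup>+\<^sup>+ x y"

definition laplacian ::
  "('a \<Rightarrow> 'a \<Rightarrow> real) \<Rightarrow> ('a \<Rightarrow> real) \<Rightarrow> ('a \<Rightarrow> real) \<Rightarrow> 'a \<Rightarrow> real" where
  "laplacian \<omega> \<mu> f x = 1 / \<mu> x * (\<Sum>\<^sub>\<infinity>y. (f y - f x) * \<omega> x y)"

text \<open>Kernels \<open>k x y t\<close> matter only for \<open>t > 0\<close>; the Laplacian acts on the first variable.\<close>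

definition positive_fundamental_solution ::
  "('a \<Rightarrow> 'a \<Rightarrow> real) \<Rightarrow> ('a \<Rightarrow> real) \<Rightarrow> ('a \<Rightarrow> 'a \<Rightarrow> real \<Rightarrow> real) \<Rightarrow> bool" where
  "positive_fundamental_solution \<omega> \<mu> k \<longleftrightarrow>
     (\<forall>x y. \<forall>t>0. 0 < k x y t) \<and>
     (\<forall>x y. \<forall>t>0. (k x y has_real_derivative laplacian \<omega> \<mu> (\<lambda>z. k z y t) x) (at t)) \<and>
     (\<forall>x y. (k x y \<longlongrightarrow> (if x = y then 1 / \<mu> x else 0)) (at_right 0))"

definition minimal_heat_kernel ::
  "('a \<Rightarrow> 'a \<Rightarrow> real) \<Rightarrow> ('a \<Rightarrow> real) \<Rightarrow> ('a \<Rightarrow> 'a \<Rightarrow> real \<Rightarrow> real) \<Rightarrow> bool" where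
  "minimal_heat_kernel \<omega> \<mu> p \<longleftrightarrow>
     positive_fundamental_solution \<omega> \<mu> p \<and>
     (\<forall>k. positive_fundamental_solution \<omega> \<mu> k \<longrightarrow> (\<forall>x y. \<forall>t>0. p x y t \<le> k x y t))"

text \<open>
  The space \<open>L\<^sup>\<infinity>((0,\<tau>); \<ell>\<^sup>\<infinity>(G))\<close>. Measurability in time is required vertex by vertex (for
  countable \<open>G\<close> this is weak-* measurability, \<open>\<ell>\<^sup>\<infinity>\<close> being the dual of \<open>\<ell>\<^sup>1\<close>), not in the sense of
  Bochner: \<open>\<ell>\<^sup>\<infinity>\<close> is not separable and, for unbounded Laplacians, already the orbits of the heat
  semigroup on \<open>\<ell>\<^sup>\<infinity>\<close> need not be essentially separably valued.
\<close>

definition Linf_linf :: "real \<Rightarrow> ('a \<Rightarrow> real \<Rightarrow> real) \<Rightarrow> bool" where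
  "Linf_linf \<tau> u \<longleftrightarrow>
     (\<forall>x. u x \<in> borel_measurable (lebesgue_on {0<..<\<tau>})) \<and>
     (\<exists>C. AE t in lebesgue_on {0<..<\<tau>}. \<forall>x. \<bar>u x t\<bar> \<le> C)"

text \<open>
  \<open>infsum\<close> and the Bochner integral take the value 0 on divergent expressions, so convergence
  is part of the definition; as all terms are nonnegative, this says exactly that the right-hand
  side of the integral equation is finite.
\<close>

definition mild_solution ::
  "('a \<Rightarrow> real) \<Rightarrow> ('a \<Rightarrow> 'a \<Rightarrow> real \<Rightarrow> real) \<Rightarrow> (real \<Rightarrow> real) \<Rightarrow> real \<Rightarrow> ('a \<Rightarrow> real)
     \<Rightarrow> real \<Rightarrow> ('a \<Rightarrow> real \<Rightarrow> real) \<Rightarrow> bool" where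
  "mild_solution \<mu> p h q u\<^sub>0 \<tau> u \<longleftrightarrow>
     (\<forall>x. \<forall>t\<in>{0<..<\<tau>}. 0 \<le> u x t) \<and>
     Linf_linf \<tau> u \<and>
     (\<forall>x. \<forall>t\<in>{0<..<\<tau>}.
        (\<lambda>y. p x y t * u\<^sub>0 y * \<mu> y) summable_on UNIV \<and>
        (AE s in lebesgue_on {0<..<t}.
           (\<lambda>y. p x y (t - s) * h s * u y s powr q * \<mu> y) summable_on UNIV) \<and>
        integrable (lebesgue_on {0<..<t})
          (\<lambda>s. \<Sum>\<^sub>\<infinity>y. p x y (t - s) * h s * u y s powr q * \<mu> y) \<and>
        u x t = (\<Sum>\<^sub>\<infinity>y. p x y t * u\<^sub>0 y * \<mu> y)
          + (LINT s|lebesgue_on {0<..<t}. (\<Sum>\<^sub>\<infinity>y. p x y (t - s) * h s * u y s powr q * \<mu> y)))"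

end

theory Submission
  imports Defs
begin

text \<open>The heat kernel is nonnegative and continuous in time; beyond this, the proof rests on its being
  sub-Markovian, \<open>\<Sum>\<^sub>y p x y t * \<mu> y \<le> 1\<close>. Given this, a function with values in \<open>{0..B}\<close> is mapped by
  the right-hand side of the integral equation to a function bounded by
  \<open>sup u\<^sub>0 + B powr q * (integral of h over {0..t})\<close>. With \<open>B = sup u\<^sub>0 + 1\<close> this is at most \<open>B\<close> as long
  as the integral of \<open>h\<close> is at most \<open>1 / B powr q\<close>, which local integrability grants for small times.
  Since \<open>h\<close> and the kernel are nonnegative, the right-hand side is also monotone in the unknown
  function. Picard iteration from \<open>0\<close> is therefore increasing and bounded by \<open>B\<close>, and monotone
  convergence shows that its limit is a fixed point. Monotonicity takes the place of a
  contraction estimate, so that all limits are pointwise and no function space is needed.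

  The heat kernel is given only as the least positive fundamental solution, so the sub-Markov property
  has to come from comparison: it suffices to exhibit one positive fundamental solution \<open>k\<close> with
  \<open>\<Sum>\<^sub>y k x y t * \<mu> y \<le> 1\<close>. Feller's construction yields it. Let \<open>c x z = \<omega> x z / \<mu> x\<close> be the jump
  rates and \<open>d x = \<Sum>\<^sub>z c x z\<close> the exit rate of the associated Markov chain. The heat equation in the
  first variable is \<open>\<partial>\<^sub>t k x y t + d x * k x y t = \<Sum>\<^sub>z c x z * k z y t\<close>, and variation of constants turns
  it into a fixed point equation (\<open>backward_duhamel\<close>) which is again monotone. Its iterates from \<open>0\<close>
  collect the paths with a bounded number of jumps; their total mass stays at most \<open>1\<close>
  (\<open>backward_iterate_sub_stochastic\<close>), and their limit \<open>feller_kernel\<close> solves the equation. Local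
  finiteness makes the sum over \<open>z\<close> finite, hence the regularity in time is elementary, and
  connectedness makes the limit strictly positive.\<close>

section \<open>A sub-Markovian fundamental solution\<close>

context infinite_weighted_graph
begin

definition neighbours :: "'a \<Rightarrow> 'a set" where
  "neighbours x = {y. 0 < \<omega> x y}"

definition jump_rate :: "'a \<Rightarrow> 'a \<Rightarrow> real" where
  "jump_rate x y = \<omega> x y / \<mu> x"

definition exit_rate :: "'a \<Rightarrow> real" where
  "exit_rate x = (\<Sum>y\<in>neighbours x. jump_rate x y)"

lemma finite_neighbours [simp]: "finite (neighbours x)"
  unfolding neighbours_def by (rule locally_finite)

lemma jump_rate_nonneg: "0 \<le> jump_rate x y"
  unfolding jump_rate_def using weight_nonneg measure_pos[of x] by (simp add: less_imp_le)

text \<open>Local finiteness allows the gain and the loss part of the generator to be summed separately.\<close>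

lemma laplacian_jump_rates:
  "laplacian \<omega> \<mu> f x = (\<Sum>z\<in>neighbours x. jump_rate x z * f z) - exit_rate x * f x"
proof -
  have "(\<Sum>\<^sub>\<infinity>y. (f y - f x) * \<omega> x y) = (\<Sum>\<^sub>\<infinity>y\<in>neighbours x. (f y - f x) * \<omega> x y)"
    using weight_nonneg by (intro infsum_cong_neutral) (auto simp: neighbours_def less_le)
  also have "\<dots> = (\<Sum>y\<in>neighbours x. (f y - f x) * \<omega> x y)"
    by simp
  finally show ?thesis
    unfolding laplacian_def exit_rate_def jump_rate_def
    by (simp add: sum_distrib_left sum_distrib_right sum_subtractf[symmetric] algebra_simps diff_divide_distrib)
qed

definition backward_source :: "('a \<Rightarrow> 'a \<Rightarrow> real \<Rightarrow> real) \<Rightarrow> 'a \<Rightarrow> 'a \<Rightarrow> real \<Rightarrow> real" where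
  "backward_source k x y r = exp (exit_rate x * r) * (\<Sum>z\<in>neighbours x. jump_rate x z * k z y r)"

text \<open>Conditioning on the first jump: either the chain stays at \<open>x\<close> up to time \<open>t\<close>, or it jumps to some
  \<open>z\<close> and continues from there. Pulling \<open>exp (- exit_rate x * t)\<close> out of the integral, instead of writing
  a convolution in time, makes continuity and differentiability in \<open>t\<close> those of an
  indefinite integral.\<close>

definition backward_duhamel :: "('a \<Rightarrow> 'a \<Rightarrow> real \<Rightarrow> real) \<Rightarrow> 'a \<Rightarrow> 'a \<Rightarrow> real \<Rightarrow> real" where
  "backward_duhamel k x y t = exp (- exit_rate x * t) *
     ((if x = y then 1 / \<mu> x else 0) + integral {0..t} (backward_source k x y))"

text \<open>The \<open>n\<close>-th iterate is the transition density of the chain restricted to fewer than \<open>n\<close> jumps.\<close>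

definition backward_iterate :: "nat \<Rightarrow> 'a \<Rightarrow> 'a \<Rightarrow> real \<Rightarrow> real" where
  "backward_iterate n = (backward_duhamel ^^ n) (\<lambda>_ _ _. 0)"

lemma backward_iterate_0: "backward_iterate 0 x y t = 0"
  and backward_iterate_Suc: "backward_iterate (Suc n) = backward_duhamel (backward_iterate n)"
  unfolding backward_iterate_def by auto

lemma backward_source_mono:
  assumes "\<And>z. k z y r \<le> k' z y r"
  shows "backward_source k x y r \<le> backward_source k' x y r"
  unfolding backward_source_def using assms
  by (intro mult_left_mono sum_mono) (auto simp: jump_rate_nonneg)

lemma backward_source_nonneg:
  assumes "\<And>z. 0 \<le> k z y r"
  shows "0 \<le> backward_source k x y r"
  unfolding backward_source_def using assms
  by (intro mult_nonneg_nonneg sum_nonneg) (auto simp: jump_rate_nonneg)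

lemma continuous_on_backward_source:
  assumes "\<And>z. continuous_on S (k z y)"
  shows "continuous_on S (backward_source k x y)"
  unfolding backward_source_def using assms by (intro continuous_intros) auto

lemma continuous_on_backward_duhamel:
  assumes "backward_source k x y integrable_on {0..b}"
  shows "continuous_on {0..b} (backward_duhamel k x y)"
  unfolding backward_duhamel_def
  by (intro continuous_intros indefinite_integral_continuous_1[OF assms])

lemma continuous_on_backward_iterate: "continuous_on {0..b} (backward_iterate n x y)"
proof (induction n arbitrary: x)
  case 0
  then show ?case by (simp add: backward_iterate_0[abs_def])
next
  case (Suc n)
  show ?case unfolding backward_iterate_Suc
    by (intro continuous_on_backward_duhamel integrable_continuous_real
          continuous_on_backward_source Suc.IH)
qed

lemma integrable_backward_source_iterate:
  "backward_source (backward_iterate n) x y integrable_on {0..b}"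
  by (intro integrable_continuous_real continuous_on_backward_source continuous_on_backward_iterate)

lemma backward_duhamel_mono:
  assumes "\<And>z r. 0 \<le> r \<Longrightarrow> k z y r \<le> k' z y r"
    and "backward_source k x y integrable_on {0..t}"
    and "backward_source k' x y integrable_on {0..t}"
  shows "backward_duhamel k x y t \<le> backward_duhamel k' x y t"
  unfolding backward_duhamel_def using assms
  by (intro mult_left_mono add_left_mono integral_le backward_source_mono) auto

text \<open>The paths without any jump give a lower bound, which serves both for nonnegativity of the
  iterates and for positivity of the limit on the diagonal.\<close>

lemma backward_duhamel_ge_no_jump:
  assumes "\<And>z r. 0 \<le> r \<Longrightarrow> 0 \<le> k z y r"
    and "backward_source k x y integrable_on {0..t}"
  shows "exp (- exit_rate x * t) * (if x = y then 1 / \<mu> x else 0) \<le> backward_duhamel k x y t"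
proof -
  have "0 \<le> integral {0..t} (backward_source k x y)"
    using assms by (intro integral_nonneg backward_source_nonneg) auto
  then show ?thesis
    unfolding backward_duhamel_def by (intro mult_left_mono) auto
qed

lemma no_jump_nonneg: "0 \<le> exp (- exit_rate x * t) * (if x = y then 1 / \<mu> x else 0)"
  using measure_pos[of x] by (intro mult_nonneg_nonneg) auto

lemma backward_iterate_nonneg: "0 \<le> t \<Longrightarrow> 0 \<le> backward_iterate n x y t"
proof (induction n arbitrary: x t)
  case 0
  then show ?case by (simp add: backward_iterate_0)
next
  case (Suc n)
  show ?case unfolding backward_iterate_Suc
    by (rule order_trans[OF no_jump_nonneg backward_duhamel_ge_no_jump])
      (auto intro: Suc.IH integrable_backward_source_iterate)
qed

lemma backward_iterate_mono: "0 \<le> t \<Longrightarrow> backward_iterate n x y t \<le> backward_iterate (Suc n) x y t"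
proof (induction n arbitrary: x t)
  case 0
  then show ?case using backward_iterate_nonneg[of t 1] by (simp add: backward_iterate_0)
next
  case (Suc n)
  have "backward_duhamel (backward_iterate n) x y t \<le> backward_duhamel (backward_iterate (Suc n)) x y t"
    by (intro backward_duhamel_mono Suc.IH integrable_backward_source_iterate)
  then show ?case by (simp only: backward_iterate_Suc)
qed

text \<open>Conservation of probability at the first jump: if the mass after the jump is at most \<open>1\<close>, then the
  total mass is at most \<open>exp (- d * t) * (1 + \<integral>\<^sub>0\<^sup>t d * exp (d * r) dr) = 1\<close>, where \<open>d\<close> is the exit rate.\<close>

lemma backward_iterate_sub_stochastic:
  assumes "finite F" and "0 \<le> t"
  shows "(\<Sum>y\<in>F. backward_iterate n x y t * \<mu> y) \<le> 1"
  using \<open>0 \<le> t\<close>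
proof (induction n arbitrary: x t)
  case 0
  then show ?case by (simp add: backward_iterate_0)
next
  case (Suc n)
  let ?d = "exit_rate x"
  let ?S = "\<lambda>y. backward_source (backward_iterate n) x y"
  let ?e = "\<lambda>y. if x = y then 1 / \<mu> x else 0 :: real"
  have FTC: "((\<lambda>r. ?d * exp (?d * r)) has_integral exp (?d * t) - exp (?d * 0)) {0..t}"
    using Suc.prems
    by (intro fundamental_theorem_of_calculus)
      (auto intro!: derivative_eq_intros simp: has_real_derivative_iff_has_vector_derivative[symmetric])
  have int: "(\<lambda>r. ?S y r * \<mu> y) integrable_on {0..t}" for y
    by (intro integrable_on_mult_left integrable_backward_source_iterate)
  have "(\<Sum>y\<in>F. ?S y r * \<mu> y) \<le> ?d * exp (?d * r)" if "r \<in> {0..t}" for r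
  proof -
    \<comment> \<open>Interchanging the two finite sums exposes the mass of the kernel started at each neighbour.\<close>
    have "(\<Sum>y\<in>F. ?S y r * \<mu> y) = exp (?d * r) *
        (\<Sum>z\<in>neighbours x. jump_rate x z * (\<Sum>y\<in>F. backward_iterate n z y r * \<mu> y))"
      unfolding backward_source_def sum_distrib_left sum_distrib_right
      by (subst sum.swap) (simp add: mult_ac)
    also have "\<dots> \<le> exp (?d * r) * (\<Sum>z\<in>neighbours x. jump_rate x z * 1)"
      using that by (intro mult_left_mono sum_mono Suc.IH) (auto simp: jump_rate_nonneg)
    finally show ?thesis by (simp add: exit_rate_def mult_ac)
  qed
  then have "integral {0..t} (\<lambda>r. \<Sum>y\<in>F. ?S y r * \<mu> y) \<le> exp (?d * t) - exp (?d * 0)"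
    using FTC int \<open>finite F\<close>
    by (subst integral_unique[OF FTC, symmetric]) (intro integral_le integrable_sum; auto)
  moreover have "integral {0..t} (\<lambda>r. \<Sum>y\<in>F. ?S y r * \<mu> y) = (\<Sum>y\<in>F. integral {0..t} (?S y) * \<mu> y)"
    using int \<open>finite F\<close> by (subst integral_sum) auto
  ultimately have integral_le: "(\<Sum>y\<in>F. integral {0..t} (?S y) * \<mu> y) \<le> exp (?d * t) - 1"
    by simp
  have "(\<Sum>y\<in>F. ?e y * \<mu> y) = (\<Sum>y\<in>F. if x = y then 1 else 0)"
    using measure_pos by (intro sum.cong) (auto simp: less_imp_neq[symmetric])
  also have "\<dots> \<le> 1"
    using \<open>finite F\<close> by simp
  finally have "(\<Sum>y\<in>F. (?e y + integral {0..t} (?S y)) * \<mu> y) \<le> exp (?d * t)"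
    using integral_le by (simp add: distrib_right sum.distrib)
  then have "exp (- ?d * t) * (\<Sum>y\<in>F. (?e y + integral {0..t} (?S y)) * \<mu> y)
      \<le> exp (- ?d * t) * exp (?d * t)"
    by (intro mult_left_mono) auto
  also have "\<dots> = 1" by (simp add: exp_minus)
  finally show ?case
    unfolding backward_iterate_Suc backward_duhamel_def
    by (simp only: sum_distrib_left mult.assoc)
qed

text \<open>Feller's minimal solution of the backward equation: all paths with finitely many jumps.\<close>

definition feller_kernel :: "'a \<Rightarrow> 'a \<Rightarrow> real \<Rightarrow> real" where
  "feller_kernel x y t = lim (\<lambda>n. backward_iterate n x y t)"

lemma backward_iterate_le:
  assumes "0 \<le> t"
  shows "backward_iterate n x y t \<le> 1 / \<mu> y"
  using backward_iterate_sub_stochastic[of "{y}" t n x] assms measure_pos[of y]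
  by (simp add: pos_le_divide_eq)

lemma backward_iterate_tendsto:
  assumes "0 \<le> t"
  shows "(\<lambda>n. backward_iterate n x y t) \<longlonglongrightarrow> feller_kernel x y t"
proof -
  have "incseq (\<lambda>n. backward_iterate n x y t)"
    using assms by (intro incseq_SucI backward_iterate_mono)
  then obtain L where "(\<lambda>n. backward_iterate n x y t) \<longlonglongrightarrow> L"
    using incseq_convergent[of _ "1 / \<mu> y"] backward_iterate_le[OF assms] by metis
  then show ?thesis
    unfolding feller_kernel_def by (simp add: limI)
qed

lemma feller_kernel_nonneg: "0 \<le> t \<Longrightarrow> 0 \<le> feller_kernel x y t"
  using LIMSEQ_le_const[OF backward_iterate_tendsto] backward_iterate_nonneg by metis

lemma feller_kernel_sub_stochastic:
  assumes "finite F" and "0 \<le> t"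
  shows "(\<Sum>y\<in>F. feller_kernel x y t * \<mu> y) \<le> 1"
proof (rule LIMSEQ_le_const2)
  show "(\<lambda>n. \<Sum>y\<in>F. backward_iterate n x y t * \<mu> y) \<longlonglongrightarrow> (\<Sum>y\<in>F. feller_kernel x y t * \<mu> y)"
    using assms by (intro tendsto_intros backward_iterate_tendsto)
qed (use backward_iterate_sub_stochastic assms in blast)

lemma backward_source_iterate_tendsto:
  assumes "0 \<le> r"
  shows "(\<lambda>n. backward_source (backward_iterate n) x y r) \<longlonglongrightarrow> backward_source feller_kernel x y r"
  unfolding backward_source_def using assms by (intro tendsto_intros backward_iterate_tendsto)

lemma integrable_backward_source_feller:
    "backward_source feller_kernel x y integrable_on {0..t}" (is ?int)
  and integral_backward_source_iterate_tendsto: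
    "(\<lambda>n. integral {0..t} (backward_source (backward_iterate n) x y))
       \<longlonglongrightarrow> integral {0..t} (backward_source feller_kernel x y)" (is ?lim)
proof -
  have bound: "norm (backward_source (backward_iterate n) x y r) \<le> backward_source (\<lambda>_ y _. 1 / \<mu> y) x y r"
    if "r \<in> {0..t}" for n r
  proof -
    have "0 \<le> backward_source (backward_iterate n) x y r"
      using that by (intro backward_source_nonneg backward_iterate_nonneg) auto
    moreover have "backward_source (backward_iterate n) x y r \<le> backward_source (\<lambda>_ y _. 1 / \<mu> y) x y r"
      using that by (intro backward_source_mono backward_iterate_le) auto
    ultimately show ?thesis by simp
  qed
  have dom: "backward_source (\<lambda>_ y _. 1 / \<mu> y) x y integrable_on {0..t}"
    by (intro integrable_continuous_real continuous_on_backward_source continuous_intros)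
  show ?int
    by (rule dominated_convergence(1)[OF integrable_backward_source_iterate dom bound
          backward_source_iterate_tendsto]) auto
  show ?lim
    by (rule dominated_convergence(2)[OF integrable_backward_source_iterate dom bound
          backward_source_iterate_tendsto]) auto
qed

lemma feller_kernel_fixed_point:
  assumes "0 \<le> t"
  shows "feller_kernel x y t = backward_duhamel feller_kernel x y t"
proof (rule LIMSEQ_unique)
  show "(\<lambda>n. backward_iterate (Suc n) x y t) \<longlonglongrightarrow> feller_kernel x y t"
    using backward_iterate_tendsto[OF assms] by (rule LIMSEQ_Suc)
  show "(\<lambda>n. backward_iterate (Suc n) x y t) \<longlonglongrightarrow> backward_duhamel feller_kernel x y t"
    unfolding backward_iterate_Suc backward_duhamel_def
    by (intro tendsto_intros integral_backward_source_iterate_tendsto)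
qed

lemma continuous_on_feller_kernel: "continuous_on {0..b} (feller_kernel x y)"
  using continuous_on_backward_duhamel[OF integrable_backward_source_feller, of b x y]
  by (rule continuous_on_eq) (simp add: feller_kernel_fixed_point)

text \<open>Once the fixed point equation is available, a bootstrap gives smoothness in time: the integral makes
  the kernel continuous, so the integrand is continuous and the integral differentiable.\<close>

lemma feller_kernel_has_derivative:
  assumes "0 < t"
  shows "(feller_kernel x y has_real_derivative laplacian \<omega> \<mu> (\<lambda>z. feller_kernel z y t) x) (at t)"
proof -
  let ?d = "exit_rate x"
  let ?I = "\<lambda>t. integral {0..t} (backward_source feller_kernel x y)"
  have "(?I has_vector_derivative backward_source feller_kernel x y t) (at t within {0..t+1})"
    using assms by (intro integral_has_vector_derivative continuous_on_backward_source
        continuous_on_feller_kernel) auto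
  moreover have "at t within {0..t+1} = at t"
    using assms by (intro at_within_interior) (auto simp: interior_atLeastAtMost_real)
  ultimately have I: "(?I has_real_derivative backward_source feller_kernel x y t) (at t)"
    by (simp add: has_real_derivative_iff_has_vector_derivative)
  have deriv: "((\<lambda>s. exp (- ?d * s) * (c + ?I s)) has_real_derivative
      exp (- ?d * t) * backward_source feller_kernel x y t - ?d * (exp (- ?d * t) * (c + ?I t))) (at t)" for c
    by (auto intro!: derivative_eq_intros I simp: algebra_simps)
  have "(backward_duhamel feller_kernel x y has_real_derivative
      exp (- ?d * t) * backward_source feller_kernel x y t
        - ?d * backward_duhamel feller_kernel x y t) (at t)"
    unfolding backward_duhamel_def by (rule deriv)
  also have "exp (- ?d * t) * backward_source feller_kernel x y t
      - ?d * backward_duhamel feller_kernel x y t = laplacian \<omega> \<mu> (\<lambda>z. feller_kernel z y t) x"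
    using assms
    by (simp add: laplacian_jump_rates feller_kernel_fixed_point[symmetric] backward_source_def exp_minus)
  finally show ?thesis
    by (rule has_field_derivative_transform_within_open[of _ _ _ "{0<..}"])
      (use assms in \<open>auto simp: feller_kernel_fixed_point\<close>)
qed

lemma feller_kernel_initial: "(feller_kernel x y \<longlongrightarrow> (if x = y then 1 / \<mu> x else 0)) (at_right 0)"
proof -
  have "(feller_kernel x y \<longlongrightarrow> feller_kernel x y 0) (at 0 within {0..1})"
    using continuous_on_feller_kernel[of 1 x y] by (simp add: continuous_on_def)
  moreover have "feller_kernel x y 0 = (if x = y then 1 / \<mu> x else 0)"
    by (simp add: feller_kernel_fixed_point backward_duhamel_def)
  moreover have "at 0 within {0..1::real} = at_right 0"
    by (rule at_within_Icc_at_right) simp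
  ultimately show ?thesis by simp
qed

lemma feller_kernel_pos_diagonal:
  assumes "0 \<le> t"
  shows "0 < feller_kernel x x t"
proof -
  have "0 < exp (- exit_rate x * t) * (1 / \<mu> x)"
    using measure_pos[of x] by simp
  also have "\<dots> \<le> feller_kernel x x t"
    using backward_duhamel_ge_no_jump[OF feller_kernel_nonneg integrable_backward_source_feller[of x x t]] assms
    by (simp add: feller_kernel_fixed_point)
  finally show ?thesis .
qed

text \<open>Positivity spreads backwards along an edge: a path that jumps from \<open>x\<close> to \<open>z\<close> at some time before
  \<open>t\<close> and then reaches \<open>y\<close> has positive weight.\<close>

lemma feller_kernel_pos_step:
  assumes "0 < \<omega> x z" and pos: "\<And>r. 0 < r \<Longrightarrow> 0 < feller_kernel z y r" and "0 < t"
  shows "0 < feller_kernel x y t"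
proof -
  let ?S = "backward_source feller_kernel x y"
  have S_pos: "0 < ?S r" if "0 < r" for r
  proof -
    have "0 < jump_rate x z * feller_kernel z y r"
      using assms(1) pos[OF that] measure_pos[of x] by (simp add: jump_rate_def)
    then have "0 < (\<Sum>w\<in>neighbours x. jump_rate x w * feller_kernel w y r)"
      using assms(1) that
      by (intro sum_pos2[of _ z]) (auto simp: neighbours_def[of x] locally_finite jump_rate_nonneg feller_kernel_nonneg)
    then show ?thesis unfolding backward_source_def by simp
  qed
  have cont: "continuous_on {0..t} ?S"
    by (intro continuous_on_backward_source continuous_on_feller_kernel)
  have S_nonneg: "0 \<le> ?S r" if "r \<in> {0..t}" for r
    using that by (intro backward_source_nonneg feller_kernel_nonneg) auto
  have "integral {0..t} ?S \<noteq> 0"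
    using integral_eq_0_iff[OF cont] S_nonneg S_pos[OF \<open>0 < t\<close>] \<open>0 < t\<close> by force
  moreover have "0 \<le> integral {0..t} ?S"
    using S_nonneg by (intro integral_nonneg integrable_backward_source_feller)
  ultimately have "0 < integral {0..t} ?S" by simp
  moreover have "0 \<le> (if x = y then 1 / \<mu> x else 0)"
    using measure_pos by (simp add: less_imp_le)
  ultimately show ?thesis
    using \<open>0 < t\<close> by (simp only: feller_kernel_fixed_point backward_duhamel_def) (simp add: add_nonneg_pos)
qed

lemma feller_kernel_pos:
  assumes "0 < t"
  shows "0 < feller_kernel x y t"
proof (cases "x = y")
  case True
  then show ?thesis using assms feller_kernel_pos_diagonal[of t] by simp
next
  case False
  then have "(\<lambda>v w. 0 < \<omega> v w)\<^sup>+\<^sup>+ x y" by (rule connected)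
  then have "\<forall>t>0. 0 < feller_kernel x y t"
    by (induction rule: converse_tranclp_induct)
      (blast intro: feller_kernel_pos_step feller_kernel_pos_diagonal less_imp_le)+
  then show ?thesis using assms by blast
qed

lemma feller_kernel_fundamental: "positive_fundamental_solution \<omega> \<mu> feller_kernel"
  unfolding positive_fundamental_solution_def
  using feller_kernel_pos feller_kernel_has_derivative feller_kernel_initial by blast

text \<open>Comparison: the least positive fundamental solution lies below \<open>feller_kernel\<close> and inherits its mass bound.\<close>

lemma minimal_heat_kernel_sub_stochastic:
  assumes "minimal_heat_kernel \<omega> \<mu> p" and "finite F" and "0 < t"
  shows "(\<Sum>y\<in>F. p x y t * \<mu> y) \<le> 1"
proof -
  have "(\<Sum>y\<in>F. p x y t * \<mu> y) \<le> (\<Sum>y\<in>F. feller_kernel x y t * \<mu> y)"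
    using assms feller_kernel_fundamental measure_pos
    by (intro sum_mono mult_right_mono) (auto simp: minimal_heat_kernel_def less_imp_le)
  also have "\<dots> \<le> 1"
    using assms by (intro feller_kernel_sub_stochastic) auto
  finally show ?thesis .
qed

lemma minimal_heat_kernel_pos:
  "minimal_heat_kernel \<omega> \<mu> p \<Longrightarrow> 0 < t \<Longrightarrow> 0 < p x y t"
  by (simp add: minimal_heat_kernel_def positive_fundamental_solution_def)

lemma minimal_heat_kernel_measurable:
  assumes "minimal_heat_kernel \<omega> \<mu> p"
  shows "(\<lambda>t. if 0 < t then p x y t else 0) \<in> borel_measurable borel"
proof -
  have "isCont (p x y) t" if "0 < t" for t
    using assms that DERIV_isCont
    unfolding minimal_heat_kernel_def positive_fundamental_solution_def by blast
  then have "continuous_on {0<..} (p x y)"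
    by (intro continuous_at_imp_continuous_on) auto
  then have "(\<lambda>t. if t \<in> {0<..} then p x y t else 0) \<in> borel_measurable borel"
    by (intro borel_measurable_continuous_on_if) auto
  then show ?thesis by simp
qed

end

section \<open>Countable sums as integrals, and the source near time zero\<close>

text \<open>The vertex sums are treated as integrals over the counting measure, so that the convergence theorems
  for nonnegative integrals apply to them directly.\<close>

lemma measurable_nn_integral_count_space:
  fixes f :: "'b \<Rightarrow> 'c \<Rightarrow> ennreal"
  assumes "countable A" and "\<And>y. y \<in> A \<Longrightarrow> f y \<in> borel_measurable N"
  shows "(\<lambda>x. \<integral>\<^sup>+y. f y x \<partial>count_space A) \<in> borel_measurable N"
proof -
  interpret sigma_finite_measure "count_space A"
    using assms(1) by (rule sigma_finite_measure_count_space_countable)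
  have "(\<lambda>(y, x). f y x) \<in> borel_measurable (count_space A \<Otimes>\<^sub>M N)"
    using assms by (intro measurable_pair_measure_countable1) auto
  from measurable_pair_swap[OF this]
  have "(\<lambda>(x, y). f y x) \<in> borel_measurable (N \<Otimes>\<^sub>M count_space A)"
    by (simp add: case_prod_unfold)
  then show ?thesis
    by (rule borel_measurable_nn_integral)
qed

lemma nn_integral_count_space_infsum:
  fixes f :: "'b \<Rightarrow> real"
  assumes "\<And>y. 0 \<le> f y" and "(\<integral>\<^sup>+y. ennreal (f y) \<partial>count_space UNIV) \<noteq> top"
  shows "f summable_on UNIV"
    and "infsum f UNIV = enn2real (\<integral>\<^sup>+y. ennreal (f y) \<partial>count_space UNIV)"
proof -
  have "integrable (count_space UNIV) f"
    using assms by (intro integrableI_bounded) (auto simp: less_top)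
  then have summable: "Infinite_Set_Sum.abs_summable_on f UNIV"
    by (simp add: Infinite_Set_Sum.abs_summable_on_def)
  then show "f summable_on UNIV"
    using abs_summable_equivalent abs_summable_summable by blast
  show "infsum f UNIV = enn2real (\<integral>\<^sup>+y. ennreal (f y) \<partial>count_space UNIV)"
    using infsetsum_infsum[OF summable] infsetsum_conv_nn_integral[of UNIV f] assms by simp
qed

lemma nn_integral_count_space_le_finite_sums:
  fixes f :: "'b \<Rightarrow> real"
  assumes "\<And>y. 0 \<le> f y" and "\<And>F. finite F \<Longrightarrow> sum f F \<le> C"
  shows "(\<integral>\<^sup>+y. ennreal (f y) \<partial>count_space UNIV) \<le> ennreal C"
proof -
  have summable: "f summable_on UNIV"
    using assms by (intro nonneg_bdd_above_summable_on bdd_aboveI2) auto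
  then have abs: "Infinite_Set_Sum.abs_summable_on f UNIV"
    using assms(1) by (subst abs_summable_equivalent[symmetric]) simp
  have "(\<integral>\<^sup>+y. ennreal (f y) \<partial>count_space UNIV) = ennreal (infsum f UNIV)"
    using nn_integral_conv_infsetsum[OF abs] infsetsum_infsum[OF abs] assms(1) by simp
  also have "\<dots> \<le> ennreal C"
    using summable assms(2) by (intro ennreal_leI infsum_le_finite_sums) auto
  finally show ?thesis .
qed

text \<open>For a Borel function \<open>g\<close> the map \<open>(t, s) \<mapsto> K x y (t - s) * g s\<close> is Borel on the plane, which gives
  measurability in \<open>t\<close> of its integral over \<open>s\<close>; a Lebesgue measurable \<open>g\<close> need not have this property.
  The source may be replaced because a change on a null set does not affect the integral equation.\<close>

lemma integrable_lebesgue_on_borel_representative: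
  fixes h :: "real \<Rightarrow> real"
  assumes "integrable (lebesgue_on S) h" and "S \<in> sets lebesgue" and "\<And>s. s \<in> S \<Longrightarrow> 0 \<le> h s"
  obtains g where "g \<in> borel_measurable borel" and "\<And>s. 0 \<le> g s" and "integrable lborel g"
    and "AE s in lborel. s \<in> S \<longrightarrow> g s = h s"
proof -
  let ?h = "\<lambda>s. indicator S s *\<^sub>R h s"
  have h_int: "integrable lebesgue ?h"
    using assms(1,2) by (simp add: integrable_restrict_space)
  then obtain g where g [measurable]: "g \<in> borel_measurable lborel" and eq: "AE s in lborel. ?h s = g s"
    using completion_ex_borel_measurable_real[of ?h lborel] by auto
  have "integrable lebesgue g"
    using h_int integrable_cong_AE[OF borel_measurable_integrable[OF h_int] measurable_completion[OF g] AE_completion[OF eq]]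
    by simp
  then have g_int: "integrable lborel g"
    by (simp add: integrable_completion)
  show ?thesis
  proof
    show "(\<lambda>s. max 0 (g s)) \<in> borel_measurable borel" "0 \<le> max 0 (g s)" for s
      using g by auto
    show "integrable lborel (\<lambda>s. max 0 (g s))"
      using g_int by auto
    show "AE s in lborel. s \<in> S \<longrightarrow> max 0 (g s) = h s"
      using eq
    proof eventually_elim
      case (elim s)
      then show ?case
        using assms(3)[of s] by (auto simp: indicator_def)
    qed
  qed
qed

lemma integral_near_zero_small:
  fixes f :: "real \<Rightarrow> real"
  assumes "integrable lborel f" and "0 < \<epsilon>"
  obtains \<tau> where "0 < \<tau>" and "\<tau> \<le> 1" and "(LBINT s. indicator {0<..<\<tau>} s * f s) < \<epsilon>"
proof -
  let ?f = "\<lambda>n s. indicator {0<..<1 / real (Suc n)} s * f s"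
  have [measurable]: "f \<in> borel_measurable borel"
    using assms(1) by auto
  \<comment> \<open>The intervals are open at 0, so their indicators vanish eventually at every point, also at 0 itself.\<close>
  have "(\<lambda>n. ?f n s) \<longlonglongrightarrow> 0" for s
  proof (cases "0 < s")
    case True
    have "\<forall>\<^sub>F n in sequentially. 1 / real (Suc n) < s"
      using True lim_1_over_n[THEN LIMSEQ_Suc] by (intro order_tendstoD(2)) 
    then have "\<forall>\<^sub>F n in sequentially. ?f n s = 0"
      by eventually_elim (auto simp: indicator_def)
    then show ?thesis by (rule tendsto_eventually)
  qed auto
  then have "(\<lambda>n. integral\<^sup>L lborel (?f n)) \<longlonglongrightarrow> integral\<^sup>L lborel (\<lambda>_::real. 0)"
    using assms(1)
    by - (rule integral_dominated_convergence[where w = "\<lambda>s. norm (f s)"],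
        auto simp: indicator_def)
  then have "\<forall>\<^sub>F n in sequentially. (LBINT s. ?f n s) < \<epsilon>"
    using assms(2) by (intro order_tendstoD(2)) auto
  then obtain n where "(LBINT s. ?f n s) < \<epsilon>"
    by (meson eventually_sequentially order_refl)
  then show ?thesis
    by (intro that[of "1 / real (Suc n)"]) auto
qed

section \<open>Monotone Picard iteration\<close>

text \<open>The kernel is defined for all times; in the application it vanishes for nonpositive times and \<open>g\<close>
  vanishes outside a bounded interval starting at \<open>0\<close>, so that the convolution over the whole line is the one
  over \<open>{0<..<t}\<close>. The last assumption says that \<open>{0..B}\<close> is invariant under the right-hand side of the
  integral equation.\<close>

locale monotone_picard =
  fixes K :: "'a \<Rightarrow> 'a \<Rightarrow> real \<Rightarrow> real" and \<mu> :: "'a \<Rightarrow> real"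
    and g :: "real \<Rightarrow> real" and q :: real and u\<^sub>0 :: "'a \<Rightarrow> real" and M B :: real
  assumes countable_space: "countable (UNIV :: 'a set)"
    and kernel_measurable [measurable]: "K x y \<in> borel_measurable borel"
    and kernel_nonneg: "0 \<le> K x y t"
    and mass_nonneg: "0 \<le> \<mu> y"
    and kernel_sub_stochastic: "(\<integral>\<^sup>+y. ennreal (K x y t * \<mu> y) \<partial>count_space UNIV) \<le> 1"
    and source_measurable [measurable]: "g \<in> borel_measurable borel"
    and source_nonneg: "0 \<le> g s"
    and exponent_pos: "0 < q"
    and initial_nonneg: "0 \<le> u\<^sub>0 y"
    and initial_le: "u\<^sub>0 y \<le> M"
    and bound_nonneg: "0 \<le> B"
    and bound_invariant:
      "ennreal M + (\<integral>\<^sup>+s. ennreal (g s) \<partial>lborel) * ennreal (B powr q) \<le> ennreal B"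
begin

text \<open>Extended nonnegative values postpone every question of convergence until the
  bound by \<open>B\<close> is known.\<close>

definition free_term :: "'a \<Rightarrow> real \<Rightarrow> ennreal" where
  "free_term x t = (\<integral>\<^sup>+y. ennreal (K x y t * u\<^sub>0 y * \<mu> y) \<partial>count_space UNIV)"

definition reaction :: "('a \<Rightarrow> real \<Rightarrow> real) \<Rightarrow> 'a \<Rightarrow> real \<Rightarrow> real \<Rightarrow> ennreal" where
  "reaction v x t s = (\<integral>\<^sup>+y. ennreal (K x y (t - s) * g s * v y s powr q * \<mu> y) \<partial>count_space UNIV)"

definition duhamel :: "('a \<Rightarrow> real \<Rightarrow> real) \<Rightarrow> 'a \<Rightarrow> real \<Rightarrow> ennreal" where
  "duhamel v x t = free_term x t + (\<integral>\<^sup>+s. reaction v x t s \<partial>lborel)"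

lemma free_term_le: "free_term x t \<le> ennreal M"
proof -
  have "0 \<le> M"
    using initial_nonneg initial_le by (rule order_trans)
  have "free_term x t \<le> (\<integral>\<^sup>+y. ennreal M * ennreal (K x y t * \<mu> y) \<partial>count_space UNIV)"
    unfolding free_term_def
  proof (rule nn_integral_mono)
    fix y
    have "K x y t * u\<^sub>0 y * \<mu> y \<le> M * (K x y t * \<mu> y)"
      using mult_right_mono[OF initial_le, of "K x y t * \<mu> y" y] kernel_nonneg mass_nonneg
      by (simp add: mult_ac)
    then show "ennreal (K x y t * u\<^sub>0 y * \<mu> y) \<le> ennreal M * ennreal (K x y t * \<mu> y)"
      using \<open>0 \<le> M\<close> kernel_nonneg mass_nonneg by (simp add: ennreal_mult[symmetric] ennreal_leI)
  qed
  also have "\<dots> = ennreal M * (\<integral>\<^sup>+y. ennreal (K x y t * \<mu> y) \<partial>count_space UNIV)"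
    by (rule nn_integral_cmult) simp
  also have "\<dots> \<le> ennreal M"
    using mult_left_mono[OF kernel_sub_stochastic, of "ennreal M"] by simp
  finally show ?thesis .
qed

lemma reaction_le:
  assumes "\<And>y s. 0 \<le> v y s" and "\<And>y s. v y s \<le> B"
  shows "reaction v x t s \<le> ennreal (g s) * ennreal (B powr q)"
proof -
  have "reaction v x t s
      \<le> (\<integral>\<^sup>+y. ennreal (g s) * ennreal (B powr q) * ennreal (K x y (t - s) * \<mu> y) \<partial>count_space UNIV)"
    unfolding reaction_def
  proof (rule nn_integral_mono)
    fix y
    have "v y s powr q \<le> B powr q"
      using assms exponent_pos by (intro powr_mono2) auto
    then have "K x y (t - s) * g s * v y s powr q * \<mu> y \<le> g s * B powr q * (K x y (t - s) * \<mu> y)"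
      using mult_left_mono[of "v y s powr q" "B powr q" "K x y (t - s) * g s * \<mu> y"]
        kernel_nonneg mass_nonneg source_nonneg
      by (simp add: mult_ac)
    then show "ennreal (K x y (t - s) * g s * v y s powr q * \<mu> y)
        \<le> ennreal (g s) * ennreal (B powr q) * ennreal (K x y (t - s) * \<mu> y)"
      using kernel_nonneg mass_nonneg source_nonneg
      by (simp add: ennreal_mult[symmetric] ennreal_leI)
  qed
  also have "\<dots> = ennreal (g s) * ennreal (B powr q) *
      (\<integral>\<^sup>+y. ennreal (K x y (t - s) * \<mu> y) \<partial>count_space UNIV)"
    by (rule nn_integral_cmult) simp
  also have "\<dots> \<le> ennreal (g s) * ennreal (B powr q)"
    using mult_left_mono[OF kernel_sub_stochastic, of "ennreal (g s) * ennreal (B powr q)"] by simp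
  finally show ?thesis .
qed

lemma duhamel_le:
  assumes "\<And>y s. 0 \<le> v y s" and "\<And>y s. v y s \<le> B"
  shows "duhamel v x t \<le> ennreal B"
proof -
  have "(\<integral>\<^sup>+s. reaction v x t s \<partial>lborel) \<le> (\<integral>\<^sup>+s. ennreal (g s) * ennreal (B powr q) \<partial>lborel)"
    using assms by (intro nn_integral_mono reaction_le)
  also have "\<dots> = (\<integral>\<^sup>+s. ennreal (g s) \<partial>lborel) * ennreal (B powr q)"
    by (rule nn_integral_multc) simp
  finally have "duhamel v x t \<le> ennreal M + (\<integral>\<^sup>+s. ennreal (g s) \<partial>lborel) * ennreal (B powr q)"
    unfolding duhamel_def using free_term_le by (intro add_mono)
  then show ?thesis
    using bound_invariant by (rule order_trans)
qed

lemma reaction_mono: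
  assumes "\<And>y s. 0 \<le> v y s" and "\<And>y s. v y s \<le> w y s"
  shows "reaction v x t s \<le> reaction w x t s"
  unfolding reaction_def using assms kernel_nonneg mass_nonneg source_nonneg exponent_pos
  by (intro nn_integral_mono ennreal_leI mult_left_mono mult_right_mono powr_mono2)
    (auto simp: less_imp_le)

lemma duhamel_mono:
  assumes "\<And>y s. 0 \<le> v y s" and "\<And>y s. v y s \<le> w y s"
  shows "duhamel v x t \<le> duhamel w x t"
  unfolding duhamel_def using assms by (intro add_left_mono nn_integral_mono reaction_mono)

lemma reaction_measurable:
  assumes [measurable]: "\<And>y. v y \<in> borel_measurable borel"
  shows "(\<lambda>(t, s). reaction v x t s) \<in> borel_measurable (borel \<Otimes>\<^sub>M lborel)"
  unfolding reaction_def case_prod_unfold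
  by (intro measurable_nn_integral_count_space countable_space) measurable

lemma duhamel_measurable:
  assumes "\<And>y. v y \<in> borel_measurable borel"
  shows "duhamel v x \<in> borel_measurable borel"
proof -
  have "(\<lambda>t. \<integral>\<^sup>+s. reaction v x t s \<partial>lborel) \<in> borel_measurable borel"
    using reaction_measurable[OF assms] by (rule lborel.borel_measurable_nn_integral)
  moreover have "free_term x \<in> borel_measurable borel"
    unfolding free_term_def
    by (intro measurable_nn_integral_count_space countable_space) measurable
  ultimately show ?thesis
    unfolding duhamel_def by measurable
qed

lemma reaction_section_measurable:
  assumes [measurable]: "\<And>y. v y \<in> borel_measurable borel"
  shows "reaction v x t \<in> borel_measurable borel"
  unfolding reaction_def
  by (intro measurable_nn_integral_count_space countable_space) measurable

lemma reaction_tendsto: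
  assumes nonneg: "\<And>n y s. 0 \<le> v n y s" and incr: "\<And>n y s. v n y s \<le> v (Suc n) y s"
    and lim: "\<And>y s. (\<lambda>n. v n y s) \<longlonglongrightarrow> w y s"
  shows "(\<lambda>n. reaction (v n) x t s) \<longlonglongrightarrow> reaction w x t s"
  unfolding reaction_def
proof (rule nn_integral_LIMSEQ)
  show "incseq (\<lambda>n y. ennreal (K x y (t - s) * g s * v n y s powr q * \<mu> y))"
    using nonneg incr kernel_nonneg mass_nonneg source_nonneg exponent_pos
    by (intro incseq_SucI le_funI ennreal_leI mult_left_mono mult_right_mono powr_mono2)
      (auto simp: less_imp_le)
  fix y
  have "(\<lambda>n. v n y s powr q) \<longlonglongrightarrow> w y s powr q"
    using nonneg exponent_pos by (intro tendsto_powr' lim tendsto_const) (auto intro: always_eventually)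
  then show "(\<lambda>n. ennreal (K x y (t - s) * g s * v n y s powr q * \<mu> y))
      \<longlonglongrightarrow> ennreal (K x y (t - s) * g s * w y s powr q * \<mu> y)"
    by (intro tendsto_ennrealI tendsto_mult tendsto_const)
qed simp

text \<open>Monotone convergence, applied to the vertex sum inside \<open>reaction\<close> and then to the time integral.\<close>

lemma duhamel_tendsto:
  assumes "\<And>n y s. 0 \<le> v n y s" and "\<And>n y s. v n y s \<le> v (Suc n) y s"
    and "\<And>y s. (\<lambda>n. v n y s) \<longlonglongrightarrow> w y s"
    and "\<And>n y. v n y \<in> borel_measurable borel"
  shows "(\<lambda>n. duhamel (v n) x t) \<longlonglongrightarrow> duhamel w x t"
  unfolding duhamel_def
proof (intro tendsto_add tendsto_const nn_integral_LIMSEQ)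
  show "incseq (\<lambda>n. reaction (v n) x t)"
    using assms(1,2) by (intro incseq_SucI le_funI reaction_mono)
  show "reaction (v n) x t \<in> borel_measurable lborel" for n
    using reaction_section_measurable[of "v n"] assms(4) by simp
  show "(\<lambda>n. reaction (v n) x t s) \<longlonglongrightarrow> reaction w x t s" for s
    using assms(1-3) by (rule reaction_tendsto)
qed

primrec picard :: "nat \<Rightarrow> 'a \<Rightarrow> real \<Rightarrow> real" where
  "picard 0 = (\<lambda>x t. 0)"
| "picard (Suc n) = (\<lambda>x t. enn2real (duhamel (picard n) x t))"

lemma picard_nonneg: "0 \<le> picard n x t"
  by (cases n) auto

lemma picard_le: "picard n x t \<le> B"
proof (induction n arbitrary: x t)
  case (Suc n)
  then have "duhamel (picard n) x t \<le> ennreal B"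
    by (intro duhamel_le picard_nonneg)
  then show ?case
    using bound_nonneg by (simp add: enn2real_leI)
qed (simp add: bound_nonneg)

lemma ennreal_picard_Suc: "ennreal (picard (Suc n) x t) = duhamel (picard n) x t"
  using duhamel_le[of "picard n" x t] picard_nonneg picard_le
  by (simp add: ennreal_enn2real_if top_unique) (metis ennreal_neq_top top_unique)

lemma picard_mono: "picard n x t \<le> picard (Suc n) x t"
proof (induction n arbitrary: x t)
  case 0
  then show ?case using picard_nonneg[of "Suc 0"] by simp
next
  case (Suc n)
  then have "duhamel (picard n) x t \<le> duhamel (picard (Suc n)) x t"
    by (intro duhamel_mono picard_nonneg)
  then show ?case
    using picard_nonneg by (simp only: ennreal_picard_Suc[symmetric] ennreal_le_iff)
qed

lemma picard_measurable: "picard n x \<in> borel_measurable borel"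
proof (induction n arbitrary: x)
  case (Suc n)
  then have [measurable]: "duhamel (picard n) x \<in> borel_measurable borel"
    by (rule duhamel_measurable)
  show ?case by simp
qed simp

definition solution :: "'a \<Rightarrow> real \<Rightarrow> real" where
  "solution x t = lim (\<lambda>n. picard n x t)"

lemma picard_tendsto: "(\<lambda>n. picard n x t) \<longlonglongrightarrow> solution x t"
proof -
  have "incseq (\<lambda>n. picard n x t)"
    by (intro incseq_SucI picard_mono)
  then obtain L where "(\<lambda>n. picard n x t) \<longlonglongrightarrow> L"
    using incseq_convergent[of _ B] picard_le by metis
  then show ?thesis
    unfolding solution_def by (simp add: limI)
qed

lemma solution_nonneg: "0 \<le> solution x t"
  using LIMSEQ_le_const[OF picard_tendsto] picard_nonneg by blast

lemma solution_le: "solution x t \<le> B"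
  using LIMSEQ_le_const2[OF picard_tendsto] picard_le by blast

lemma solution_measurable: "solution x \<in> borel_measurable borel"
  by (rule borel_measurable_LIMSEQ_metric[of "\<lambda>n. picard n x"])
    (auto intro: picard_measurable picard_tendsto)

lemma solution_fixed_point: "ennreal (solution x t) = duhamel solution x t"
proof (rule LIMSEQ_unique)
  show "(\<lambda>n. ennreal (picard (Suc n) x t)) \<longlonglongrightarrow> ennreal (solution x t)"
    by (intro tendsto_ennrealI LIMSEQ_Suc picard_tendsto)
  show "(\<lambda>n. ennreal (picard (Suc n) x t)) \<longlonglongrightarrow> duhamel solution x t"
    unfolding ennreal_picard_Suc
    by (intro duhamel_tendsto picard_nonneg picard_mono picard_tendsto picard_measurable)
qed

lemma free_term_infsum:
  shows "(\<lambda>y. K x y t * u\<^sub>0 y * \<mu> y) summable_on UNIV"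
    and "(\<Sum>\<^sub>\<infinity>y. K x y t * u\<^sub>0 y * \<mu> y) = enn2real (free_term x t)"
proof -
  have "free_term x t \<noteq> top"
    using free_term_le[of x t] by (auto simp: top_unique)
  then show "(\<lambda>y. K x y t * u\<^sub>0 y * \<mu> y) summable_on UNIV"
    and "(\<Sum>\<^sub>\<infinity>y. K x y t * u\<^sub>0 y * \<mu> y) = enn2real (free_term x t)"
    unfolding free_term_def
    by (auto intro!: nn_integral_count_space_infsum simp: kernel_nonneg mass_nonneg initial_nonneg)
qed

lemma reaction_infsum:
  shows "(\<lambda>y. K x y (t - s) * g s * solution y s powr q * \<mu> y) summable_on UNIV"
    and "(\<Sum>\<^sub>\<infinity>y. K x y (t - s) * g s * solution y s powr q * \<mu> y) = enn2real (reaction solution x t s)"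
proof -
  have "reaction solution x t s \<noteq> top"
    using reaction_le[of solution x t s] solution_nonneg solution_le
    by (auto simp: top_unique ennreal_mult[symmetric] source_nonneg)
  then show "(\<lambda>y. K x y (t - s) * g s * solution y s powr q * \<mu> y) summable_on UNIV"
    and "(\<Sum>\<^sub>\<infinity>y. K x y (t - s) * g s * solution y s powr q * \<mu> y) = enn2real (reaction solution x t s)"
    unfolding reaction_def
    by (auto intro!: nn_integral_count_space_infsum simp: kernel_nonneg mass_nonneg source_nonneg)
qed

text \<open>Finiteness of all terms, a consequence of the bound by \<open>B\<close>, turns the fixed point equation
  into one between real sums and integrals.\<close>

lemma solution_integral_equation:
  fixes x :: 'a and t :: real
  defines "R \<equiv> \<lambda>s. \<Sum>\<^sub>\<infinity>y. K x y (t - s) * g s * solution y s powr q * \<mu> y"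
  shows "integrable lborel R"
    and "solution x t = (\<Sum>\<^sub>\<infinity>y. K x y t * u\<^sub>0 y * \<mu> y) + (LBINT s. R s)"
proof -
  have reaction_finite: "reaction solution x t s \<noteq> top" for s
    using reaction_le[of solution x t s] solution_nonneg solution_le
    by (auto simp: top_unique ennreal_mult[symmetric] source_nonneg)
  have R: "R s = enn2real (reaction solution x t s)" for s
    unfolding R_def by (rule reaction_infsum)
  have [measurable]: "reaction solution x t \<in> borel_measurable borel"
    by (intro reaction_section_measurable solution_measurable)
  have [measurable]: "R \<in> borel_measurable borel"
    unfolding R[abs_def] by measurable
  have R_ennreal: "ennreal (R s) = reaction solution x t s" for s
    unfolding R using reaction_finite by (simp add: less_top)
  have fixed: "ennreal (solution x t) = free_term x t + (\<integral>\<^sup>+s. ennreal (R s) \<partial>lborel)"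
    unfolding R_ennreal using solution_fixed_point by (simp add: duhamel_def)
  then have fin: "free_term x t \<noteq> top" "(\<integral>\<^sup>+s. ennreal (R s) \<partial>lborel) \<noteq> top"
    by (metis ennreal_neq_top ennreal_add_eq_top)+
  show "integrable lborel R"
    using fin(2) by (intro integrableI_bounded) (auto simp: R less_top)
  have "solution x t = enn2real (free_term x t + (\<integral>\<^sup>+s. ennreal (R s) \<partial>lborel))"
    unfolding fixed[symmetric] by (simp add: solution_nonneg)
  also have "\<dots> = enn2real (free_term x t) + enn2real (\<integral>\<^sup>+s. ennreal (R s) \<partial>lborel)"
    using fin by (intro enn2real_plus) (auto simp: less_top)
  also have "enn2real (\<integral>\<^sup>+s. ennreal (R s) \<partial>lborel) = (LBINT s. R s)"
    by (subst integral_eq_nn_integral) (auto simp: R)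
  finally show "solution x t = (\<Sum>\<^sub>\<infinity>y. K x y t * u\<^sub>0 y * \<mu> y) + (LBINT s. R s)"
    by (simp add: free_term_infsum)
qed

end

section \<open>Local existence\<close>

text \<open>The fixed point was found for the extended kernel, a Borel source cut off at \<open>\<tau>\<close>, and integrals over
  the whole line. For \<open>t < T \<le> \<tau>\<close> the integrand vanishes outside \<open>{0<..<t}\<close> and agrees there almost everywhere
  with the one of the mild formulation.\<close>

lemma mild_solution_if_picard:
  fixes \<tau> :: real and p :: "'a \<Rightarrow> 'a \<Rightarrow> real \<Rightarrow> real"
  defines "K \<equiv> \<lambda>x y t. if 0 < t then p x y t else 0"
  assumes picard: "monotone_picard K \<mu> (\<lambda>s. indicator {0<..<\<tau>} s * g s) q u\<^sub>0 M B"
    and g_eq: "AE s in lborel. s \<in> {0<..<\<tau>} \<longrightarrow> g s = h s"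
    and "T \<le> \<tau>"
  shows "\<exists>u. mild_solution \<mu> p h q u\<^sub>0 T u"
proof -
  interpret monotone_picard K \<mu> "\<lambda>s. indicator {0<..<\<tau>} s * g s" q u\<^sub>0 M B
    by (rule picard)
  have "mild_solution \<mu> p h q u\<^sub>0 T solution"
    unfolding mild_solution_def
  proof (intro conjI allI ballI)
    show "Linf_linf T solution"
      unfolding Linf_linf_def
    proof (intro conjI allI exI)
      show "solution x \<in> borel_measurable (lebesgue_on {0<..<T})" for x
        using solution_measurable[of x] by (intro measurable_restrict_space1 measurable_completion) simp
      show "AE t in lebesgue_on {0<..<T}. \<forall>x. \<bar>solution x t\<bar> \<le> B"
        using solution_nonneg solution_le by simp
    qed
  next
    fix x t assume t: "t \<in> {0<..<T}"
    define f where "f s y = p x y (t - s) * h s * solution y s powr q * \<mu> y" for s y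
    define k where "k s y = K x y (t - s) * (indicator {0<..<\<tau>} s * g s) * solution y s powr q * \<mu> y" for s y
    let ?S = "{0<..<t}"
    have free: "K x y t * u\<^sub>0 y * \<mu> y = p x y t * u\<^sub>0 y * \<mu> y" for y
      using t by (simp add: K_def)
    show "(\<lambda>y. p x y t * u\<^sub>0 y * \<mu> y) summable_on UNIV"
      using free_term_infsum(1)[of x t] unfolding free .
    have "AE s in lborel. s \<in> ?S \<longrightarrow> k s = f s"
      using g_eq
    proof eventually_elim
      case (elim s)
      show ?case
      proof
        assume "s \<in> ?S"
        then have "g s = h s" and "s \<in> {0<..<\<tau>}" and "0 < t - s"
          using elim t \<open>T \<le> \<tau>\<close> by auto
        then show "k s = f s"
          by (simp add: k_def f_def K_def fun_eq_iff)
      qed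
    qed
    then have eq: "AE s in lebesgue. s \<in> ?S \<longrightarrow> k s = f s"
      by (rule AE_completion)
    have k_summable: "k s summable_on UNIV" for s
      unfolding k_def by (rule reaction_infsum)
    have "AE s in lebesgue. s \<in> ?S \<longrightarrow> f s summable_on UNIV"
      using eq by eventually_elim (metis k_summable)
    then show "AE s in lebesgue_on ?S. (\<lambda>y. p x y (t - s) * h s * solution y s powr q * \<mu> y) summable_on UNIV"
      unfolding f_def[symmetric] by (simp add: AE_restrict_space_iff)
    let ?R = "\<lambda>s. infsum (k s) UNIV" and ?F = "\<lambda>s. indicator ?S s *\<^sub>R infsum (f s) UNIV"
    have R: "integrable lborel ?R" "solution x t = (\<Sum>\<^sub>\<infinity>y. K x y t * u\<^sub>0 y * \<mu> y) + (LBINT s. ?R s)"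
      unfolding k_def by (rule solution_integral_equation)+
    then have R_lebesgue: "integrable lebesgue ?R" "integral\<^sup>L lebesgue ?R = (LBINT s. ?R s)"
      by (auto simp: integrable_completion integral_completion)
    have outside: "?R s = 0" if "s \<notin> ?S" for s
    proof -
      have "k s y = 0" for y
        using that by (auto simp: k_def K_def)
      then show ?thesis by (simp add: infsum_0)
    qed
    have R_F: "AE s in lebesgue. ?R s = ?F s"
      using eq by eventually_elim (use outside in \<open>auto simp: indicator_def\<close>)
    have F_measurable: "?F \<in> borel_measurable lebesgue"
      using borel_measurable_integrable[OF R_lebesgue(1)] R_F by (rule borel_measurable_AE)
    have "integrable lebesgue ?F"
      using integrable_cong_AE[OF borel_measurable_integrable[OF R_lebesgue(1)] F_measurable R_F]
        R_lebesgue(1) by simp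
    then have "integrable (lebesgue_on ?S) (\<lambda>s. infsum (f s) UNIV)"
      by (simp add: integrable_restrict_space)
    then show "integrable (lebesgue_on ?S) (\<lambda>s. \<Sum>\<^sub>\<infinity>y. p x y (t - s) * h s * solution y s powr q * \<mu> y)"
      unfolding f_def .
    have "(LINT s|lebesgue_on ?S. infsum (f s) UNIV) = integral\<^sup>L lebesgue ?F"
      by (simp add: integral_restrict_space)
    also have "\<dots> = integral\<^sup>L lebesgue ?R"
      by (rule integral_cong_AE[OF borel_measurable_integrable[OF R_lebesgue(1)] F_measurable R_F, symmetric])
    finally have "solution x t = (\<Sum>\<^sub>\<infinity>y. p x y t * u\<^sub>0 y * \<mu> y) + (LINT s|lebesgue_on ?S. infsum (f s) UNIV)"
      using R(2) R_lebesgue(2) unfolding free by simp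
    then show "solution x t = (\<Sum>\<^sub>\<infinity>y. p x y t * u\<^sub>0 y * \<mu> y)
        + (LINT s|lebesgue_on ?S. (\<Sum>\<^sub>\<infinity>y. p x y (t - s) * h s * solution y s powr q * \<mu> y))"
      unfolding f_def .
  qed (rule solution_nonneg)
  then show ?thesis by blast
qed

theorem theorem3p3:
  fixes \<omega> :: "'a \<Rightarrow> 'a \<Rightarrow> real" and \<mu> :: "'a \<Rightarrow> real"
    and p :: "'a \<Rightarrow> 'a \<Rightarrow> real \<Rightarrow> real"
    and h :: "real \<Rightarrow> real" and q :: real and u\<^sub>0 :: "'a \<Rightarrow> real"
  assumes "infinite_weighted_graph \<omega> \<mu>"
    and "minimal_heat_kernel \<omega> \<mu> p"
    and "\<And>t. 0 \<le> t \<Longrightarrow> 0 \<le> h t"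
    and "\<And>R. integrable (lebesgue_on {0..R}) h"
    and "1 < q"
    and "\<And>x. 0 \<le> u\<^sub>0 x"
    and "bounded (range u\<^sub>0)"
  shows "\<exists>T\<^sub>0>0. \<forall>T. 0 < T \<and> T \<le> T\<^sub>0 \<longrightarrow> (\<exists>u. mild_solution \<mu> p h q u\<^sub>0 T u)"
proof -
  interpret infinite_weighted_graph \<omega> \<mu> by (rule assms(1))
  obtain M where M: "\<And>x. u\<^sub>0 x \<le> M"
    using assms(7) unfolding bounded_iff by (metis abs_le_D1 rangeI real_norm_def)
  have "0 \<le> M"
    using assms(6) M by (rule order_trans)
  \<comment> \<open>The excess of \<open>B\<close> over the bound of the initial datum is the room left for the reaction term.\<close>
  define B where "B = M + 1"
  have "0 < B powr q"
    using \<open>0 \<le> M\<close> by (simp add: B_def)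
  obtain g where g [measurable]: "g \<in> borel_measurable borel" "\<And>s. 0 \<le> g s" "integrable lborel g"
    and g_eq: "AE s in lborel. s \<in> {0..1} \<longrightarrow> g s = h s"
    using integrable_lebesgue_on_borel_representative[OF assms(4)[of 1]] assms(3) by auto
  obtain \<tau> where \<tau>: "0 < \<tau>" "\<tau> \<le> 1" and small: "(LBINT s. indicator {0<..<\<tau>} s * g s) < 1 / B powr q"
    using integral_near_zero_small[OF g(3), of "1 / B powr q"] \<open>0 < B powr q\<close> by auto
  let ?g = "\<lambda>s. indicator {0<..<\<tau>} s * g s"
  define K where "K x y t = (if 0 < t then p x y t else 0)" for x y t
  have K_nonneg: "0 \<le> K x y t" for x y t
    using minimal_heat_kernel_pos[OF assms(2), of t x y] by (simp add: K_def less_imp_le)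
  have "monotone_picard K \<mu> ?g q u\<^sub>0 M B"
  proof
    show "(\<integral>\<^sup>+y. ennreal (K x y t * \<mu> y) \<partial>count_space UNIV) \<le> 1" for x t
    proof -
      have "(\<Sum>y\<in>F. K x y t * \<mu> y) \<le> 1" if "finite F" for F
        using minimal_heat_kernel_sub_stochastic[OF assms(2) that, of t x] by (cases "0 < t") (simp_all add: K_def)
      then show ?thesis
        using nn_integral_count_space_le_finite_sums[of "\<lambda>y. K x y t * \<mu> y" 1] K_nonneg measure_pos
        by (simp add: less_imp_le)
    qed
    show "ennreal M + (\<integral>\<^sup>+s. ennreal (?g s) \<partial>lborel) * ennreal (B powr q) \<le> ennreal B"
    proof -
      have "integrable lborel ?g"
        using integrable_mult_indicator[of "{0<..<\<tau>}" lborel g] g(3) by simp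
      then have "(\<integral>\<^sup>+s. ennreal (?g s) \<partial>lborel) = ennreal (LBINT s. ?g s)"
        using g(2) by (intro nn_integral_eq_integral) auto
      moreover have "(LBINT s. ?g s) * B powr q \<le> 1"
        using small \<open>0 < B powr q\<close> by (simp add: pos_less_divide_eq less_imp_le)
      moreover have "0 \<le> (LBINT s. ?g s)"
        using g(2) by (intro integral_nonneg_AE) auto
      ultimately show ?thesis
        using \<open>0 \<le> M\<close> by (simp add: B_def ennreal_mult[symmetric] ennreal_plus[symmetric] ennreal_leI del: ennreal_plus)
    qed
    show "K x y \<in> borel_measurable borel" for x y
      unfolding K_def by (rule minimal_heat_kernel_measurable[OF assms(2)])
    show "0 \<le> \<mu> y" for y
      using measure_pos[of y] by simp
  qed (use K_nonneg g assms M \<open>0 \<le> M\<close> countable_vertices in \<open>auto simp: B_def\<close>)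
  moreover have "AE s in lborel. s \<in> {0<..<\<tau>} \<longrightarrow> g s = h s"
    using g_eq by eventually_elim (use \<tau> in auto)
  ultimately have "\<exists>u. mild_solution \<mu> p h q u\<^sub>0 T u" if "T \<le> \<tau>" for T
    using mild_solution_if_picard[of p \<mu> \<tau> g q u\<^sub>0 M B h T] that unfolding K_def[abs_def] by blast
  then show ?thesis
    using \<tau>(1) by blast
qed

end
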